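(* Let $H$ be a quaternion skew field with centre $F$, and let $\parallel$ be a Clifford-like parallelism of $(\mathbb{P}(H),\parallel_{\ell},\parallel_{r})$ other than $\parallel_{\ell}$ and $\parallel_{r}$. Then there is no parallelism $\parallel'$ on $\mathbb{P}(H)$ that makes $\mathbb{P}(H)$ into a projective double space $(\mathbb{P}(H),\parallel,\parallel')$.
   Context: A quaternion skew field $H$ with centre $F$ is a quaternion algebra over the field $F$ (of any characteristic), $4$-dimensional over $F$, that is a skew field with centre $F$; $H^*:=H\setminus\{0\}$. The projective space $\mathbb{P}(H)$ is the set of all subspaces of the $F$-vector space $H$; its points and lines are the subspaces of vector dimension one and two, respectively. For lines $M,N$: $M\parallel_{\ell}N$ if there is a $c\in H^*$ with $cM=N$; $M\parallel_{r}N$ if there is a $d\in H^*$ with $Md=N$. A parallelism on a projective space is an equivalence relation on its set of lines such that each point is incident with precisely one line from each equivalence class. A projective space $\mathbb{P}$ with two (not necessarily distinct) parallelisms $\parallel_1$ ("left") and $\parallel_2$ ("right") is a projective double space $(\mathbb{P},\parallel_1,\parallel_2)$ if for all triangles $p_0,p_1,p_2$ in $\mathbb{P}$ the lines $M_1$ and $M_2$ have a common point, where $M_1$ is the line through $p_2$ with $M_1\parallel_1$ (join of $p_0$ and $p_1$), and $M_2$ is the line through $p_1$ with $M_2\parallel_2$ (join of $p_0$ and $p_2$). It is known that $(\mathbb{P}(H),\parallel_{\ell},\parallel_{r})$ is a projective double space. A Clifford-like parallelism of $(\mathbb{P}(H),\parallel_{\ell},\parallel_{r})$ is a parallelism $\parallel$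 on $\mathbb{P}(H)$ such that for all lines $M,N$: $M\parallel N$ implies ($M\parallel_{\ell}N$ or $M\parallel_{r}N$). *)

theory Defs
  imports Main HOL.Vector_Spaces
begin

locale projective_space = vector_space scale
  for scale :: "'a::field \<Rightarrow> 'b::ab_group_add \<Rightarrow> 'b"
begin

definition proj_points :: "'b set set" where
  "proj_points = {V. subspace V \<and> dim V = 1}"

definition proj_lines :: "'b set set" where
  "proj_lines = {V. subspace V \<and> dim V = 2}"

definition proj_join :: "'b set \<Rightarrow> 'b set \<Rightarrow> 'b set" where
  "proj_join p q = span (p \<union> q)"

definition triangle :: "'b set \<Rightarrow> 'b set \<Rightarrow> 'b set \<Rightarrow> bool" where
  "triangle p\<^sub>0 p\<^sub>1 p\<^sub>2 \<longleftrightarrow>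
     p\<^sub>0 \<in> proj_points \<and> p\<^sub>1 \<in> proj_points \<and> p\<^sub>2 \<in> proj_points \<and>
     p\<^sub>0 \<noteq> p\<^sub>1 \<and> p\<^sub>0 \<noteq> p\<^sub>2 \<and> p\<^sub>1 \<noteq> p\<^sub>2 \<and>
     \<not> (\<exists>L\<in>proj_lines. p\<^sub>0 \<subseteq> L \<and> p\<^sub>1 \<subseteq> L \<and> p\<^sub>2 \<subseteq> L)"

definition parallelism :: "('b set \<times> 'b set) set \<Rightarrow> bool" where
  "parallelism R \<longleftrightarrow>
     equiv proj_lines R \<and>
     (\<forall>p\<in>proj_points. \<forall>S\<in>proj_lines // R. \<exists>!M. M \<in> S \<and> p \<subseteq> M)"

text \<open>The lines M and N below exist and are unique because both relations are
  parallelisms and the joins are lines.\<close>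

definition projective_double_space ::
    "('b set \<times> 'b set) set \<Rightarrow> ('b set \<times> 'b set) set \<Rightarrow> bool" where
  "projective_double_space R\<^sub>1 R\<^sub>2 \<longleftrightarrow>
     parallelism R\<^sub>1 \<and> parallelism R\<^sub>2 \<and>
     (\<forall>p\<^sub>0 p\<^sub>1 p\<^sub>2 M N.
        triangle p\<^sub>0 p\<^sub>1 p\<^sub>2 \<longrightarrow>
        M \<in> proj_lines \<longrightarrow> p\<^sub>2 \<subseteq> M \<longrightarrow> (M, proj_join p\<^sub>0 p\<^sub>1) \<in> R\<^sub>1 \<longrightarrow>
        N \<in> proj_lines \<longrightarrow> p\<^sub>1 \<subseteq> N \<longrightarrow> (N, proj_join p\<^sub>0 p\<^sub>2) \<in> R\<^sub>2 \<longrightarrow>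
        (\<exists>q\<in>proj_points. q \<subseteq> M \<and> q \<subseteq> N))"

end

text \<open>The presentation in \<open>quaternion_basis\<close> is the one valid in every characteristic:
  the algebra is L + Lv, where L = F + Fu is a separable quadratic F-algebra with
  nontrivial automorphism taking u to 1 - u, which is conjugation by v. If 2 is invertible,
  then i = 2u - 1 and j = v satisfy the classical relations
  i * i = 1 + 4 a, j * j = b and j * i = - (i * j).
  Since the dimension is 4, the spanning elements 1, u, v, u * v form a basis.\<close>

locale quaternion_algebra = vector_space scale
  for scale :: "'f::field \<Rightarrow> 'h::ring_1 \<Rightarrow> 'h" (infixr \<open>*s\<close> 75) +
  assumes scale_mult_left: "(c *s x) * y = c *s (x * y)"
    and scale_mult_right: "x * (c *s y) = c *s (x * y)"
    and dim_UNIV_4: "dim (UNIV :: 'h set) = 4"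
    and quaternion_basis: "\<exists>a b u v. 1 + 4 * a \<noteq> 0 \<and> b \<noteq> 0 \<and>
          u * u = u + a *s 1 \<and> v * v = b *s 1 \<and> v * u = (1 - u) * v \<and>
          span {1, u, v, u * v} = UNIV"

text \<open>The centre F is represented by an abstract field \<open>'f\<close>, identified with its image
  under the structure map sending c to \<open>c *s 1\<close>.\<close>

locale quaternion_skew_field = quaternion_algebra scale + projective_space scale
  for scale :: "'f::field \<Rightarrow> 'h::division_ring \<Rightarrow> 'h" (infixr \<open>*s\<close> 75) +
  assumes centre: "{z :: 'h. \<forall>x. z * x = x * z} = range (\<lambda>c. c *s 1)"
begin

definition left_parallel :: "('h set \<times> 'h set) set" where
  "left_parallel =
     {(M, N). M \<in> proj_lines \<and> N \<in> proj_lines \<and> (\<exists>c. c \<noteq> 0 \<and> (\<lambda>x. c * x) ` M = N)}"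

definition right_parallel :: "('h set \<times> 'h set) set" where
  "right_parallel =
     {(M, N). M \<in> proj_lines \<and> N \<in> proj_lines \<and> (\<exists>d. d \<noteq> 0 \<and> (\<lambda>x. x * d) ` M = N)}"

definition clifford_like :: "('h set \<times> 'h set) set \<Rightarrow> bool" where
  "clifford_like R \<longleftrightarrow> parallelism R \<and>
     (\<forall>M N. (M, N) \<in> R \<longrightarrow> (M, N) \<in> left_parallel \<or> (M, N) \<in> right_parallel)"

end

end

theory Submission
  imports Defs
begin

text \<open>
  Let \<open>\<parallel>\<close> be Clifford-like, and suppose that \<open>\<parallel>'\<close> completes it to a projective double space.

  Every line through the point \<open>F1\<close> has the form \<open>L = F1 + Fx\<close> with \<open>x\<close> not in the centre \<open>F\<close>, and
  it is the commutant of \<open>x\<close>, hence a subfield (\<open>span_one_eq_commutant\<close>). The parallel class of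
  \<open>L\<close> consists either of all left cosets \<open>yL\<close> or of all right cosets \<open>Ly\<close>
  (\<open>left_or_right_type\<close>); call \<open>x\<close> of left or right type accordingly. If all noncentral elements
  are of left type then \<open>\<parallel>\<close> is the left parallelism, and likewise on the right. So if \<open>\<parallel>\<close> is
  neither, then there are an element that is only of left type and one that is only of right type.

  The double space axiom then determines \<open>\<parallel>'\<close>. Let \<open>K = F1 + Fw\<close> be a line through \<open>F1\<close>, let \<open>x\<close>
  lie outside \<open>K\<close>, and let \<open>N\<close> be the line through \<open>x\<close> with \<open>N \<parallel>' K\<close>. For each noncentral \<open>y\<close>
  in \<open>K\<close> the axiom for the triangle \<open>F1\<close>, \<open>Fx\<close>, \<open>Fy\<close> makes \<open>N\<close> meet the line \<open>yL\<close> or \<open>Ly\<close>.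
  Comparing \<open>y = w\<close> with \<open>y = w + 1\<close> shows that \<open>wx\<close> lies in \<open>N\<close> if \<open>x\<close> is of left type, and
  that \<open>xw\<close> lies in \<open>N\<close> if \<open>x\<close> is of right type (\<open>double_space_translate\<close>).

  Now let \<open>x\<close> be of left type and \<open>z\<close> of right type, not commuting, and choose \<open>w = x z\<^sup>-\<^sup>1\<close>. The
  line \<open>N\<close> through \<open>x\<close> contains \<open>w\<^sup>-\<^sup>1 x = z\<close>, hence it is also the line through \<open>z\<close>, and so it
  contains \<open>z w = z x z\<^sup>-\<^sup>1\<close>. Thus \<open>z x z\<^sup>-\<^sup>1\<close> is a linear combination of \<open>z\<close> and \<open>x\<close>. The types of
  \<open>x\<close> and \<open>z\<close> do not change when scalars are added to them, and the relations obtained for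
  \<open>x + 1\<close>, \<open>z + 1\<close> and \<open>z - 1\<close> together force \<open>z\<^sup>2\<close> and \<open>zx - xz\<close> to be central
  (\<open>left_right_type_square_central\<close>).

  Finally \<open>H\<close> has a noncentral element \<open>u\<close> with \<open>u\<^sup>2 = u + a\<close>, \<open>a\<close> in \<open>F\<close>. It has a type, so it
  can be taken as \<open>x\<close> or as \<open>z\<close> with a suitable partner, and either choice makes \<open>u\<close> central, or a
  nonzero commutator vanish.
\<close>

section \<open>Points, lines and parallelisms in terms of vectors\<close>

lemma (in vector_space) span_pair_iff:
  "v \<in> span {x, y} \<longleftrightarrow> (\<exists>a b. v = scale a x + scale b y)"
  by (auto simp: span_breakdown_eq span_singleton algebra_simps image_iff)

text \<open>The dimension of a space without a finite basis is zero by convention, so the positive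
  cardinality guarantees a finite basis, against which a larger independent set can be bounded.\<close>

lemma (in vector_space) independent_subset_card_eq_dim_spans:
  assumes "independent S" "finite S" "S \<subseteq> V" "card S = dim V" "card S > 0"
  shows "V \<subseteq> span S"
proof (rule ccontr)
  assume "\<not> V \<subseteq> span S"
  then obtain v where v: "v \<in> V" "v \<notin> span S" by blast
  then have v': "v \<notin> S" using span_base by blast
  obtain B where B: "B \<subseteq> V" "independent B" "V \<subseteq> span B" "card B = dim V"
    using basis_exists by blast
  have "finite B" using B(4) assms(4,5) by (intro card_ge_0_finite) simp
  moreover have "independent (insert v S)" using v(2) assms(1) by (rule independent_insertI)
  moreover have "insert v S \<subseteq> span B" using v(1) assms(3) B(3) by blast
  ultimately have "card (insert v S) \<le> card B" using independent_span_bound by blast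
  then show False using v' B(4) assms(2,4) by simp
qed

lemma (in vector_space) dim_nonzero_imp_nonzero_vector:
  assumes "dim V \<noteq> 0" obtains v where "v \<in> V" "v \<noteq> 0"
proof -
  have "\<not> V \<subseteq> {0}"
  proof
    assume "V \<subseteq> {0}"
    then have "dim V \<le> card ({} :: 'b set)" by (intro dim_le_card) auto
    then show False using assms by simp
  qed
  then show thesis using that by blast
qed

context projective_space
begin

lemma independent_pair:
  assumes "x \<noteq> 0" "y \<notin> span {x}"
  shows "independent {x, y}" and "card {x, y} = 2"
proof -
  have "independent {y, x}" using assms by (intro independent_insertI[of y "{x}"]) simp_all
  then show "independent {x, y}" by (simp add: insert_commute)
  have "x \<noteq> y" using assms(2) span_base by blast
  then show "card {x, y} = 2" by simp
qed

lemma span_pair_in_proj_lines: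
  assumes "x \<noteq> 0" "y \<notin> span {x}"
  shows "span {x, y} \<in> proj_lines"
  using independent_pair[OF assms] dim_span_eq_card_independent[of "{x, y}"]
  unfolding proj_lines_def by simp

lemma subspace_proj_line: "V \<in> proj_lines \<Longrightarrow> subspace V"
  by (simp add: proj_lines_def)

lemma proj_line_eq_span:
  assumes "V \<in> proj_lines" "x \<in> V" "y \<in> V" "x \<noteq> 0" "y \<notin> span {x}"
  shows "V = span {x, y}"
proof (rule equalityI)
  show "V \<subseteq> span {x, y}"
    using assms independent_pair[OF assms(4,5)]
    by (intro independent_subset_card_eq_dim_spans) (auto simp: proj_lines_def)
  show "span {x, y} \<subseteq> V"
    using assms by (intro span_minimal) (auto simp: proj_lines_def)
qed

lemma proj_line_second_generator:
  assumes "V \<in> proj_lines" "x \<in> V" "x \<noteq> 0"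
  obtains y where "y \<in> V" "y \<notin> span {x}" "V = span {x, y}"
proof -
  have "\<not> V \<subseteq> span {x}"
  proof
    assume "V \<subseteq> span {x}"
    then have "dim V \<le> card {x}" by (rule dim_le_card) simp
    then show False using assms(1) by (simp add: proj_lines_def)
  qed
  then show thesis using that proj_line_eq_span[OF assms(1,2) _ assms(3)] by blast
qed

lemma proj_line_nonzero:
  assumes "M \<in> proj_lines" obtains m where "m \<in> M" "m \<noteq> 0"
  using assms dim_nonzero_imp_nonzero_vector[of M] by (auto simp: proj_lines_def)

lemma span_singleton_in_proj_points: "x \<noteq> 0 \<Longrightarrow> span {x} \<in> proj_points"
  using dim_span_eq_card_independent[of "{x}"] by (simp add: proj_points_def)

lemma span_singleton_subset_proj_line: "V \<in> proj_lines \<Longrightarrow> span {x} \<subseteq> V \<longleftrightarrow> x \<in> V"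
  using span_base[of x "{x}"] span_minimal[of "{x}" V] by (auto simp: proj_lines_def)

lemma parallel_in_proj_lines:
  assumes "parallelism R" "(M, N) \<in> R"
  shows "M \<in> proj_lines" "N \<in> proj_lines"
proof -
  have "equiv proj_lines R" using assms(1) by (simp add: parallelism_def)
  from equiv_type[OF this] show "M \<in> proj_lines" "N \<in> proj_lines" using assms(2) by blast+
qed

lemma parallel_refl: "parallelism R \<Longrightarrow> M \<in> proj_lines \<Longrightarrow> (M, M) \<in> R"
  unfolding parallelism_def equiv_def by (blast dest: refl_onD)

lemma parallel_sym: "parallelism R \<Longrightarrow> (M, N) \<in> R \<Longrightarrow> (N, M) \<in> R"
  unfolding parallelism_def equiv_def by (blast dest: symD)

lemma parallel_trans: "parallelism R \<Longrightarrow> (M, N) \<in> R \<Longrightarrow> (N, P) \<in> R \<Longrightarrow> (M, P) \<in> R"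
  unfolding parallelism_def equiv_def by (blast dest: transD)

lemma parallel_ex1:
  assumes R: "parallelism R" and A: "A \<in> proj_lines" and x: "x \<noteq> 0"
  shows "\<exists>!M. (M, A) \<in> R \<and> x \<in> M"
proof -
  have "\<forall>p\<in>proj_points. \<forall>S\<in>proj_lines // R. \<exists>!M. M \<in> S \<and> p \<subseteq> M"
    using R by (simp add: parallelism_def)
  from bspec[OF bspec[OF this span_singleton_in_proj_points[OF x]] quotientI[OF A]]
  have "\<exists>!M. (A, M) \<in> R \<and> span {x} \<subseteq> M" by simp
  moreover have "(A, M) \<in> R \<and> span {x} \<subseteq> M \<longleftrightarrow> (M, A) \<in> R \<and> x \<in> M" for M
    using parallel_sym[OF R] parallel_in_proj_lines[OF R] span_singleton_subset_proj_line by metis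
  ultimately show ?thesis by simp
qed

lemma parallel_exists:
  assumes "parallelism R" "A \<in> proj_lines" "x \<noteq> 0"
  obtains M where "(M, A) \<in> R" "x \<in> M"
  using parallel_ex1[OF assms] by blast

lemma parallel_unique:
  assumes R: "parallelism R" and M: "(M, A) \<in> R" "x \<in> M" and N: "(N, A) \<in> R" "x \<in> N"
    and x: "x \<noteq> 0"
  shows "M = N"
  using parallel_ex1[OF R parallel_in_proj_lines(2)[OF R M(1)] x] M N by blast

text \<open>The double space axiom in vector form: the triangle is formed by the points spanned by \<open>e\<close>,
  \<open>x\<close> and \<open>y\<close>, and the hypotheses on \<open>x\<close> and \<open>y\<close> say that the three vectors are independent.\<close>

lemma double_space_meet:
  assumes D: "projective_double_space R R'"
    and e: "e \<noteq> 0" and x: "x \<notin> span {e}" and y: "y \<notin> span {e, x}"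
    and M: "(M, span {e, x}) \<in> R" "y \<in> M" and N: "(N, span {e, y}) \<in> R'" "x \<in> N"
  obtains q where "q \<noteq> 0" "q \<in> M" "q \<in> N"
proof -
  have R: "parallelism R" "parallelism R'" using D by (auto simp: projective_double_space_def)
  have Ml: "M \<in> proj_lines" and Nl: "N \<in> proj_lines"
    using parallel_in_proj_lines R M(1) N(1) by blast+
  have x0: "x \<noteq> 0" and y0: "y \<noteq> 0" using x y span_zero[of "{e}"] span_zero[of "{e, x}"] by auto
  have ye: "y \<notin> span {e}" and yx: "y \<notin> span {x}"
    using y span_mono[of "{e}" "{e, x}"] span_mono[of "{x}" "{e, x}"] by auto
  have "triangle (span {e}) (span {x}) (span {y})"
    unfolding triangle_def
  proof (intro conjI notI)
    show "span {e} \<in> proj_points" "span {x} \<in> proj_points" "span {y} \<in> proj_points"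
      using e x0 y0 by (auto intro: span_singleton_in_proj_points)
    show False if "span {e} = span {x}" using that x span_base[of x "{x}"] by auto
    show False if "span {e} = span {y}" using that ye span_base[of y "{y}"] by auto
    show False if "span {x} = span {y}" using that yx span_base[of y "{y}"] by auto
    show False if ex: "\<exists>L\<in>proj_lines. span {e} \<subseteq> L \<and> span {x} \<subseteq> L \<and> span {y} \<subseteq> L"
    proof -
      obtain L where L: "L \<in> proj_lines" "span {e} \<subseteq> L" "span {x} \<subseteq> L" "span {y} \<subseteq> L"
        using ex by blast
      then have "e \<in> L" "x \<in> L" "y \<in> L"
        by (simp_all add: span_singleton_subset_proj_line)
      with L(1) show False using proj_line_eq_span[of L e x] e x y by simp
    qed
  qed
  moreover have join: "proj_join (span {a}) (span {b}) = span {a, b}" for a b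
    unfolding proj_join_def span_eq
    using span_mono[of "{a}" "{a, b}"] span_mono[of "{b}" "{a, b}"] span_base[of a "{a}"]
      span_base[of b "{b}"] span_superset[of "span {a} \<union> span {b}"] by blast
  moreover have "span {y} \<subseteq> M" "span {x} \<subseteq> N"
    using M(2) N(2) Ml Nl by (simp_all add: span_singleton_subset_proj_line)
  moreover have "triangle p\<^sub>0 p\<^sub>1 p\<^sub>2 \<Longrightarrow> p\<^sub>2 \<subseteq> M \<Longrightarrow> (M, proj_join p\<^sub>0 p\<^sub>1) \<in> R \<Longrightarrow>
      p\<^sub>1 \<subseteq> N \<Longrightarrow> (N, proj_join p\<^sub>0 p\<^sub>2) \<in> R' \<Longrightarrow> \<exists>q\<in>proj_points. q \<subseteq> M \<and> q \<subseteq> N" for p\<^sub>0 p\<^sub>1 p\<^sub>2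
    using D Ml Nl unfolding projective_double_space_def by blast
  ultimately obtain p where p: "p \<in> proj_points" "p \<subseteq> M" "p \<subseteq> N"
    using M(1) N(1) by metis
  obtain q where "q \<in> p" "q \<noteq> 0"
    using p(1) dim_nonzero_imp_nonzero_vector[of p] by (auto simp: proj_points_def)
  then show thesis using p that by blast
qed

end


section \<open>Lines through the unit element\<close>

context quaternion_skew_field
begin

lemma scalar_mult [simp]: "(c *s 1) * x = c *s x" "x * (c *s 1) = c *s x"
  by (simp_all add: scale_mult_left scale_mult_right)

lemma in_span_one_iff_central: "z \<in> span {1} \<longleftrightarrow> (\<forall>y. z * y = y * z)"
  using centre by (auto simp: span_singleton)

definition commutant :: "'h \<Rightarrow> 'h set" where
  "commutant x = {y. x * y = y * x}"

lemma subspace_commutant: "subspace (commutant x)"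
  by (rule subspaceI) (auto simp: commutant_def scale_mult_left scale_mult_right algebra_simps)

text \<open>If the commutant of \<open>x\<close> had a third independent element \<open>z\<close>, then \<open>1, x, z\<close> and some \<open>y\<close> not
  commuting with \<open>x\<close> would form a basis. In this basis \<open>y x\<close> has the form \<open>k y + c\<close> with \<open>c\<close> in the
  commutant, so \<open>y = c (x - k)\<^sup>-\<^sup>1\<close> would commute with \<open>x\<close> after all. In particular each line through
  \<open>1\<close> is closed under multiplication and inverses.\<close>

lemma span_one_eq_commutant:
  assumes x: "x \<notin> span {1}"
  shows "span {1, x} = commutant x"
proof (rule equalityI)
  show "span {1, x} \<subseteq> commutant x"
    by (intro span_minimal subspace_commutant) (simp add: commutant_def)
  show "commutant x \<subseteq> span {1, x}"
  proof (rule ccontr)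
    assume "\<not> commutant x \<subseteq> span {1, x}"
    then obtain z where z: "z \<in> commutant x" "z \<notin> span {1, x}" by blast
    obtain y where y: "x * y \<noteq> y * x" using x in_span_one_iff_central by blast
    have sub: "span {z, x, 1} \<subseteq> commutant x"
      using z(1) by (intro span_minimal subspace_commutant) (simp add: commutant_def)
    have y': "y \<notin> span {z, x, 1}" using sub y by (auto simp: commutant_def)
    have "independent {x, 1}" using x by (intro independent_insertI[of x "{1}"]) simp_all
    then have "independent {z, x, 1}"
      using z(2) by (intro independent_insertI[of z "{x, 1}"]) (simp_all add: insert_commute)
    then have ind: "independent {y, z, x, 1}"
      using y' by (intro independent_insertI[of y "{z, x, 1}"])
    have "x \<noteq> 1" using x span_base[of 1 "{1}"] by auto
    moreover have "z \<notin> {x, 1}" using z(2) span_superset[of "{1, x}"] by auto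
    moreover have "y \<notin> {z, x, 1}" using y' span_superset[of "{z, x, 1}"] by auto
    ultimately have "card {y, z, x, 1} = 4" by simp
    then have "UNIV \<subseteq> span {y, z, x, 1}"
      using ind dim_UNIV_4 by (intro independent_subset_card_eq_dim_spans) simp_all
    then have "y * x \<in> span (insert y {z, x, 1})" by blast
    then obtain k where "y * x - k *s y \<in> span {z, x, 1}" unfolding span_breakdown_eq by blast
    moreover define x' where "x' = x - k *s 1"
    ultimately have "y * x' \<in> commutant x" using sub by (auto simp: algebra_simps)
    moreover have "x * x' = x' * x" by (simp add: x'_def algebra_simps)
    ultimately have "(x * y) * x' = (y * x) * x'"
      by (simp add: commutant_def mult.assoc)
    moreover have "x' \<noteq> 0" using x by (auto simp: x'_def span_singleton)
    ultimately show False using y by simp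
  qed
qed

lemma commute_imp_in_span:
  assumes "x \<notin> span {1}" "x * y = y * x"
  shows "y \<in> span {1, x}"
  using assms by (simp add: span_one_eq_commutant commutant_def)

lemma in_span_imp_commute: "y \<in> span {1, x} \<Longrightarrow> x * y = y * x"
  using span_minimal[OF _ subspace_commutant, of "{1, x}" x] by (auto simp: commutant_def)

lemma line_through_one: "x \<notin> span {1} \<Longrightarrow> span {1, x} \<in> proj_lines"
  by (intro span_pair_in_proj_lines) simp_all

lemma right_multiple_not_in_span:
  assumes "x \<notin> span {1}" "y \<noteq> 0"
  shows "y * x \<notin> span {y}"
proof
  assume "y * x \<in> span {y}"
  then obtain c where "y * x = y * (c *s 1)" by (auto simp: span_singleton)
  then have "x = c *s 1" using mult_left_cancel[OF assms(2)] by blast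
  then show False using assms(1) by (simp add: span_singleton)
qed

lemma left_multiple_not_in_span:
  assumes "x \<notin> span {1}" "y \<noteq> 0"
  shows "x * y \<notin> span {y}"
proof
  assume "x * y \<in> span {y}"
  then obtain c where "x * y = (c *s 1) * y" by (auto simp: span_singleton)
  then have "x = c *s 1" using mult_right_cancel[OF assms(2)] by blast
  then show False using assms(1) by (simp add: span_singleton)
qed

lemma left_mult_image_span_pair: "(\<lambda>y. c * y) ` span {p, q} = span {c * p, c * q}"
proof -
  have "c * (a *s p + b *s q) = a *s (c * p) + b *s (c * q)" for a b
    by (simp add: distrib_left scale_mult_right)
  then show ?thesis
    unfolding set_eq_iff image_iff Bex_def span_pair_iff by metis
qed

lemma right_mult_image_span_pair: "(\<lambda>y. y * d) ` span {p, q} = span {p * d, q * d}"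
proof -
  have "(a *s p + b *s q) * d = a *s (p * d) + b *s (q * d)" for a b
    by (simp add: distrib_right scale_mult_left)
  then show ?thesis
    unfolding set_eq_iff image_iff Bex_def span_pair_iff by metis
qed

section \<open>Parallel classes of Clifford-like parallelisms\<close>

text \<open>With \<open>L = span {1, x}\<close>, stability of a line \<open>M\<close> under right multiplication by \<open>x\<close> says that
  \<open>M = y L\<close> for every nonzero \<open>y\<close> in \<open>M\<close>. So \<open>x\<close> is of left type iff the class of \<open>L\<close> consists of the
  left cosets of \<open>L\<close>. Stability is easier to transport along parallel lines than a coset equation.\<close>

definition left_type :: "('h set \<times> 'h set) set \<Rightarrow> 'h \<Rightarrow> bool" where
  "left_type R x \<longleftrightarrow> (\<forall>M. (M, span {1, x}) \<in> R \<longrightarrow> (\<forall>y\<in>M. y * x \<in> M))"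

definition right_type :: "('h set \<times> 'h set) set \<Rightarrow> 'h \<Rightarrow> bool" where
  "right_type R x \<longleftrightarrow> (\<forall>M. (M, span {1, x}) \<in> R \<longrightarrow> (\<forall>y\<in>M. x * y \<in> M))"

text \<open>Left multiplications commute with right multiplications, so left parallel lines are stable under
  the same right multiplications; symmetrically for right parallel lines.\<close>

lemma left_parallel_stable_iff:
  assumes "(M, N) \<in> left_parallel"
  shows "(\<forall>y\<in>M. y * x \<in> M) \<longleftrightarrow> (\<forall>y\<in>N. y * x \<in> N)"
proof -
  obtain c where c: "c \<noteq> 0" "N = (\<lambda>y. c * y) ` M"
    using assms by (auto simp: left_parallel_def)
  then have "c * y \<in> N \<longleftrightarrow> y \<in> M" for y by auto
  then show ?thesis using c by (auto simp: mult.assoc)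
qed

lemma right_parallel_stable_iff:
  assumes "(M, N) \<in> right_parallel"
  shows "(\<forall>y\<in>M. x * y \<in> M) \<longleftrightarrow> (\<forall>y\<in>N. x * y \<in> N)"
proof -
  obtain d where d: "d \<noteq> 0" "N = (\<lambda>y. y * d) ` M"
    using assms by (auto simp: right_parallel_def)
  then have "y * d \<in> N \<longleftrightarrow> y \<in> M" for y by auto
  then show ?thesis using d by (auto simp: mult.assoc[symmetric])
qed

lemma line_through_one_stable:
  assumes "x \<notin> span {1}" "y \<in> span {1, x}"
  shows "y * x \<in> span {1, x}" "x * y \<in> span {1, x}"
  using assms unfolding span_one_eq_commutant[OF assms(1)] commutant_def
  by (simp_all add: mult.assoc[symmetric])

text \<open>Each member of the class of \<open>span {1, x}\<close> is stable under right or under left multiplication by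
  \<open>x\<close>, but a priori different members could be stable under different ones. Two members of which
  one is stable only under left and the other only under right multiplication are themselves
  related by \<open>R\<close>, hence left or right parallel, and this forces a common stability.\<close>

lemma left_or_right_type:
  assumes R: "clifford_like R" and x: "x \<notin> span {1}"
  shows "left_type R x \<or> right_type R x"
proof (rule ccontr)
  assume "\<not> ?thesis"
  then obtain M\<^sub>1 M\<^sub>2
    where M1: "(M\<^sub>1, span {1, x}) \<in> R" "\<not> (\<forall>y\<in>M\<^sub>1. y * x \<in> M\<^sub>1)"
      and M2: "(M\<^sub>2, span {1, x}) \<in> R" "\<not> (\<forall>y\<in>M\<^sub>2. x * y \<in> M\<^sub>2)"
    unfolding left_type_def right_type_def by blast
  have P: "parallelism R" using R by (simp add: clifford_like_def)
  have C: "(M, N) \<in> left_parallel \<or> (M, N) \<in> right_parallel" if "(M, N) \<in> R" for M N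
    using R that by (simp add: clifford_like_def)
  have L: "\<forall>y\<in>span {1, x}. y * x \<in> span {1, x}" "\<forall>y\<in>span {1, x}. x * y \<in> span {1, x}"
    using line_through_one_stable[OF x] by blast+
  from C[OF M1(1)] have M1': "\<forall>y\<in>M\<^sub>1. x * y \<in> M\<^sub>1"
    using left_parallel_stable_iff[of M\<^sub>1 _ x] right_parallel_stable_iff[of M\<^sub>1 _ x] M1(2) L
    by blast
  from C[OF M2(1)] have M2': "\<forall>y\<in>M\<^sub>2. y * x \<in> M\<^sub>2"
    using left_parallel_stable_iff[of M\<^sub>2 _ x] right_parallel_stable_iff[of M\<^sub>2 _ x] M2(2) L
    by blast
  have "(M\<^sub>1, M\<^sub>2) \<in> R"
    using parallel_trans[OF P M1(1) parallel_sym[OF P M2(1)]] .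
  from C[OF this] show False
    using left_parallel_stable_iff[of M\<^sub>1 M\<^sub>2 x] right_parallel_stable_iff[of M\<^sub>1 M\<^sub>2 x]
      M1(2) M2(2) M1' M2' by blast
qed

text \<open>Type is a property of the line \<open>span {1, x}\<close>; in particular adding a scalar to \<open>x\<close> does not
  change it.\<close>

lemma left_type_same_line:
  assumes R: "parallelism R" and x: "left_type R x" and xz: "span {1, z} = span {1, x}"
  shows "left_type R z"
  unfolding left_type_def xz
proof (intro allI impI ballI)
  fix M y assume M: "(M, span {1, x}) \<in> R" "y \<in> M"
  have "z \<in> span {1, x}" using xz span_base[of z "{1, z}"] by simp
  then obtain a b where "z = a *s 1 + b *s x" by (auto simp: span_pair_iff)
  then have "y * z = a *s y + b *s (y * x)" by (simp add: distrib_left scale_mult_right)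
  moreover have "subspace M" using M(1) R parallel_in_proj_lines subspace_proj_line by blast
  moreover have "y * x \<in> M" using x M by (simp add: left_type_def)
  ultimately show "y * z \<in> M" using M(2) by (simp add: subspace_add subspace_scale)
qed

lemma right_type_same_line:
  assumes R: "parallelism R" and x: "right_type R x" and xz: "span {1, z} = span {1, x}"
  shows "right_type R z"
  unfolding right_type_def xz
proof (intro allI impI ballI)
  fix M y assume M: "(M, span {1, x}) \<in> R" "y \<in> M"
  have "z \<in> span {1, x}" using xz span_base[of z "{1, z}"] by simp
  then obtain a b where "z = a *s 1 + b *s x" by (auto simp: span_pair_iff)
  then have "z * y = a *s y + b *s (x * y)" by (simp add: distrib_right scale_mult_left)
  moreover have "subspace M" using M(1) R parallel_in_proj_lines subspace_proj_line by blast
  moreover have "x * y \<in> M" using x M by (simp add: right_type_def)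
  ultimately show "z * y \<in> M" using M(2) by (simp add: subspace_add subspace_scale)
qed

lemma left_type_line_eq_span:
  assumes "parallelism R" "left_type R x" "x \<notin> span {1}"
    and "(M, span {1, x}) \<in> R" "m \<in> M" "m \<noteq> 0"
  shows "M = span {m, m * x}"
  using assms parallel_in_proj_lines(1)[OF assms(1,4)] right_multiple_not_in_span[of x m]
  by (intro proj_line_eq_span) (auto simp: left_type_def)

lemma right_type_line_eq_span:
  assumes "parallelism R" "right_type R x" "x \<notin> span {1}"
    and "(M, span {1, x}) \<in> R" "m \<in> M" "m \<noteq> 0"
  shows "M = span {m, x * m}"
  using assms parallel_in_proj_lines(1)[OF assms(1,4)] left_multiple_not_in_span[of x m]
  by (intro proj_line_eq_span) (auto simp: right_type_def)

lemma parallel_through_one: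
  assumes R: "parallelism R" and M: "M \<in> proj_lines"
  obtains x where "x \<notin> span {1}" "(M, span {1, x}) \<in> R"
proof -
  obtain L where L: "(L, M) \<in> R" "1 \<in> L" using parallel_exists[OF R M, of 1] by auto
  obtain x where "x \<notin> span {1}" "L = span {1, x}"
    using proj_line_second_generator[OF parallel_in_proj_lines(1)[OF R L(1)] L(2)] by auto
  then show thesis using that parallel_sym[OF R L(1)] by simp
qed

text \<open>Through each point there is only one line of the class of \<open>span {1, x}\<close>, and it is spanned by
  \<open>m\<close> and \<open>m * x\<close> for each of its nonzero vectors \<open>m\<close>. Hence two related lines containing \<open>m\<close> and
  \<open>n\<close> differ by left multiplication with \<open>n * inverse m\<close>, and conversely a left multiple of a line
  of the class is the unique line of the class through one of its points.\<close>

lemma all_left_type_imp_left_parallel: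
  assumes R: "parallelism R" and all: "\<And>x. x \<notin> span {1} \<Longrightarrow> left_type R x"
  shows "R = left_parallel"
proof (rule set_eqI, clarify)
  fix M N
  show "(M, N) \<in> R \<longleftrightarrow> (M, N) \<in> left_parallel"
  proof (cases "M \<in> proj_lines \<and> N \<in> proj_lines")
    case False
    then show ?thesis using parallel_in_proj_lines[OF R] by (auto simp: left_parallel_def)
  next
    case True
    obtain x where x: "x \<notin> span {1}" and M: "(M, span {1, x}) \<in> R"
      using parallel_through_one[OF R] True by blast
    note line = left_type_line_eq_span[OF R all[OF x] x]
    show ?thesis
    proof
      assume MN: "(M, N) \<in> R"
      obtain m n where mn: "m \<in> M" "m \<noteq> 0" "n \<in> N" "n \<noteq> 0"
        using proj_line_nonzero True by metis
      have N: "(N, span {1, x}) \<in> R" using parallel_trans[OF R parallel_sym[OF R MN] M] .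
      define c where "c = n * inverse m"
      have c: "c * m = n" using mn(2) by (simp add: c_def mult.assoc)
      have "(\<lambda>y. c * y) ` span {m, m * x} = span {n, n * x}"
        by (simp add: left_mult_image_span_pair c mult.assoc[symmetric])
      moreover have "M = span {m, m * x}" "N = span {n, n * x}"
        using line M N mn by blast+
      moreover have "c \<noteq> 0" using c mn(4) by auto
      ultimately show "(M, N) \<in> left_parallel"
        using True unfolding left_parallel_def by blast
    next
      assume MN: "(M, N) \<in> left_parallel"
      then have stable: "\<forall>y\<in>N. y * x \<in> N"
        using left_parallel_stable_iff all[OF x] M unfolding left_type_def by blast
      obtain n where n: "n \<in> N" "n \<noteq> 0" using proj_line_nonzero True by blast
      obtain N' where N': "(N', span {1, x}) \<in> R" "n \<in> N'"
        using parallel_exists[OF R line_through_one[OF x] n(2)] .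
      have "N = span {n, n * x}"
        using True n stable right_multiple_not_in_span[OF x n(2)] by (intro proj_line_eq_span) auto
      then have "N' = N" using line[OF N' n(2)] by simp
      then show "(M, N) \<in> R" using parallel_trans[OF R M parallel_sym[OF R N'(1)]] by simp
    qed
  qed
qed

lemma all_right_type_imp_right_parallel:
  assumes R: "parallelism R" and all: "\<And>x. x \<notin> span {1} \<Longrightarrow> right_type R x"
  shows "R = right_parallel"
proof (rule set_eqI, clarify)
  fix M N
  show "(M, N) \<in> R \<longleftrightarrow> (M, N) \<in> right_parallel"
  proof (cases "M \<in> proj_lines \<and> N \<in> proj_lines")
    case False
    then show ?thesis using parallel_in_proj_lines[OF R] by (auto simp: right_parallel_def)
  next
    case True
    obtain x where x: "x \<notin> span {1}" and M: "(M, span {1, x}) \<in> R"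
      using parallel_through_one[OF R] True by blast
    note line = right_type_line_eq_span[OF R all[OF x] x]
    show ?thesis
    proof
      assume MN: "(M, N) \<in> R"
      obtain m n where mn: "m \<in> M" "m \<noteq> 0" "n \<in> N" "n \<noteq> 0"
        using proj_line_nonzero True by metis
      have N: "(N, span {1, x}) \<in> R" using parallel_trans[OF R parallel_sym[OF R MN] M] .
      define d where "d = inverse m * n"
      have d: "m * d = n" using mn(2) by (simp add: d_def mult.assoc[symmetric])
      have "(\<lambda>y. y * d) ` span {m, x * m} = span {n, x * n}"
        by (simp add: right_mult_image_span_pair d mult.assoc)
      moreover have "M = span {m, x * m}" "N = span {n, x * n}"
        using line M N mn by blast+
      moreover have "d \<noteq> 0" using d mn(4) by auto
      ultimately show "(M, N) \<in> right_parallel"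
        using True unfolding right_parallel_def by blast
    next
      assume MN: "(M, N) \<in> right_parallel"
      then have stable: "\<forall>y\<in>N. x * y \<in> N"
        using right_parallel_stable_iff all[OF x] M unfolding right_type_def by blast
      obtain n where n: "n \<in> N" "n \<noteq> 0" using proj_line_nonzero True by blast
      obtain N' where N': "(N', span {1, x}) \<in> R" "n \<in> N'"
        using parallel_exists[OF R line_through_one[OF x] n(2)] .
      have "N = span {n, x * n}"
        using True n stable left_multiple_not_in_span[OF x n(2)] by (intro proj_line_eq_span) auto
      then have "N' = N" using line[OF N' n(2)] by simp
      then show "(M, N) \<in> R" using parallel_trans[OF R M parallel_sym[OF R N'(1)]] by simp
    qed
  qed
qed

section \<open>How a double space determines its second parallelism\<close>

text \<open>The map \<open>f\<close> stands for right multiplication by \<open>x\<close> (left type) or left multiplication by \<open>x\<close>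
  (right type), so that both cases are treated at once.

  For noncentral \<open>y\<close> in \<open>K = span {1, w}\<close> the line of the class of \<open>span {1, x}\<close> through \<open>y\<close> is
  spanned by \<open>y\<close> and \<open>f y\<close>. The axiom provides a nonzero vector of it in \<open>N\<close>; since \<open>N\<close> and \<open>K\<close> are
  disjoint, it can be scaled to \<open>f y + a y\<close>. Subtracting the vectors for \<open>y = w\<close> and \<open>y = w + 1\<close>, and
  then \<open>x\<close>, leaves a vector of \<open>N\<close> that lies in \<open>K\<close>, hence is zero, and this gives \<open>a = 0\<close>.\<close>

lemma double_space_translate:
  assumes D: "projective_double_space R R'"
    and stable: "\<And>M y. (M, span {1, x}) \<in> R \<Longrightarrow> y \<in> M \<Longrightarrow> f y \<in> M"
    and f_add: "\<And>y z. f (y + z) = f y + f z" and f_one: "f 1 = x"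
    and f_indep: "\<And>y. y \<noteq> 0 \<Longrightarrow> f y \<notin> span {y}"
    and w: "w \<notin> span {1}" and x: "x \<notin> span {1, w}"
    and N: "(N, span {1, w}) \<in> R'" "x \<in> N"
  shows "f w \<in> N"
proof -
  have R: "parallelism R" "parallelism R'" using D by (auto simp: projective_double_space_def)
  have N_line: "N \<in> proj_lines" using parallel_in_proj_lines(1)[OF R(2) N(1)] .
  have N_sub: "subspace N" using subspace_proj_line[OF N_line] .
  have K: "span {1, w} \<in> proj_lines" using line_through_one[OF w] .
  have x1: "x \<notin> span {1}" using x span_mono[of "{1}" "{1, w}"] by auto
  have disjoint: "y = 0" if "y \<in> N" "y \<in> span {1, w}" for y
    using parallel_unique[OF R(2) N(1) that(1) parallel_refl[OF R(2) K] that(2)] N(2) x by auto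
  have near: "\<exists>a. f y + a *s y \<in> N" if y: "y \<in> span {1, w}" "y \<notin> span {1}" for y
  proof -
    have Ky: "span {1, w} = span {1, y}"
      using y by (intro proj_line_eq_span[OF K]) (auto intro: span_base)
    have y0: "y \<noteq> 0" using y(2) span_zero[of "{1}"] by auto
    \<comment> \<open>Otherwise \<open>x\<close> commutes with \<open>y\<close> and so lies in the commutant of \<open>y\<close>, which is \<open>K\<close>.\<close>
    have yx: "y \<notin> span {1, x}"
    proof
      assume "y \<in> span {1, x}"
      then have "y * x = x * y" using in_span_imp_commute[of y x] by simp
      then show False using commute_imp_in_span[OF y(2)] x Ky by simp
    qed
    obtain M where M: "(M, span {1, x}) \<in> R" "y \<in> M"
      using parallel_exists[OF R(1) line_through_one[OF x1] y0] .
    obtain q where q: "q \<noteq> 0" "q \<in> M" "q \<in> N"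
      using double_space_meet[OF D _ x1 yx M _ N(2)] N(1) Ky by auto
    have "M = span {y, f y}"
      using stable[OF M] f_indep[OF y0] parallel_in_proj_lines(1)[OF R(1) M(1)] M(2) y0
      by (intro proj_line_eq_span)
    then obtain a b where ab: "q = a *s y + b *s f y" using q(2) by (auto simp: span_pair_iff)
    have b: "b \<noteq> 0"
    proof
      assume "b = 0"
      then have "q \<in> span {1, w}" using ab y(1) by (simp add: span_scale)
      then show False using disjoint q by blast
    qed
    have "inverse b *s q = f y + (inverse b * a) *s y"
      using b by (simp add: ab scale_right_distrib)
    then show ?thesis using subspace_scale[OF N_sub q(3)] by metis
  qed
  obtain a where a: "f w + a *s w \<in> N" using near[of w] w by (auto intro: span_base)
  have w1: "w + 1 \<notin> span {1}"
    using w span_add_eq2[of 1 "{1}" w] by (simp add: span_base)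
  have "w + 1 \<in> span {1, w}" by (intro span_add) (auto intro: span_base)
  from near[OF this w1] obtain b where b: "f (w + 1) + b *s (w + 1) \<in> N" by blast
  have "(f (w + 1) + b *s (w + 1)) - (f w + a *s w) - x \<in> N"
    using N_sub a b N(2) by (intro subspace_diff)
  then have "(b - a) *s w + b *s 1 \<in> N"
    by (simp add: f_add f_one algebra_simps)
  moreover have "(b - a) *s w + b *s 1 \<in> span {1, w}"
    by (intro span_add span_scale) (auto intro: span_base)
  ultimately have 0: "(b - a) *s w + b *s 1 = 0" by (rule disjoint)
  have "b = a"
  proof (rule ccontr)
    assume "b \<noteq> a"
    have "(b - a) *s w = (- b) *s 1" using 0 by (simp add: add_eq_0_iff2)
    then have "inverse (b - a) *s ((b - a) *s w) \<in> span {1}"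
      by (simp only:) (intro span_scale span_base, simp)
    then show False using \<open>b \<noteq> a\<close> w by simp
  qed
  then have "b = 0" using 0 by simp
  then show "f w \<in> N" using a \<open>b = a\<close> by simp
qed


lemma double_space_left_type:
  assumes "projective_double_space R R'" "left_type R x"
    and "w \<notin> span {1}" "x \<notin> span {1, w}" "(N, span {1, w}) \<in> R'" "x \<in> N"
  shows "w * x \<in> N"
proof (rule double_space_translate[OF assms(1) _ _ _ _ assms(3-6)])
  have "x \<notin> span {1}" using assms(4) span_mono[of "{1}" "{1, w}"] by auto
  then show "y * x \<notin> span {y}" if "y \<noteq> 0" for y using right_multiple_not_in_span that by blast
qed (use assms(2) in \<open>auto simp: left_type_def distrib_right\<close>)

lemma double_space_right_type:
  assumes "projective_double_space R R'" "right_type R x"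
    and "w \<notin> span {1}" "x \<notin> span {1, w}" "(N, span {1, w}) \<in> R'" "x \<in> N"
  shows "x * w \<in> N"
proof (rule double_space_translate[OF assms(1) _ _ _ _ assms(3-6)])
  have "x \<notin> span {1}" using assms(4) span_mono[of "{1}" "{1, w}"] by auto
  then show "x * y \<notin> span {y}" if "y \<noteq> 0" for y using left_multiple_not_in_span that by blast
qed (use assms(2) in \<open>auto simp: right_type_def distrib_left\<close>)

section \<open>Pairs of elements of left and right type\<close>

text \<open>The vector \<open>w = x * inverse z\<close> is chosen so that \<open>x\<close> and \<open>z\<close> differ by left multiplication with
  an element of \<open>K = span {1, w}\<close>. Then the line parallel to \<open>K\<close> through \<open>x\<close>, computed from the left
  type of \<open>x\<close>, contains \<open>z\<close>; computed from the right type of \<open>z\<close>, it contains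
  \<open>z * w = z * x * inverse z\<close> as well.\<close>

lemma left_right_type_relation:
  assumes D: "projective_double_space R R'" and x: "left_type R x" and z: "right_type R z"
    and nc: "x * z \<noteq> z * x"
  obtains a b where "z * x = a *s (z * z) + b *s (x * z)"
proof -
  have R': "parallelism R'" using D by (simp add: projective_double_space_def)
  have x0: "x \<noteq> 0" and z0: "z \<noteq> 0" using nc by auto
  define w where "w = x * inverse z"
  have wz: "w * z = x" using z0 by (simp add: w_def mult.assoc)
  have w0: "w \<noteq> 0" using wz x0 by auto
  have vx: "inverse w * x = z" using w0 by (simp add: wz[symmetric] mult.assoc[symmetric])
  have w: "w \<notin> span {1}"
  proof
    assume "w \<in> span {1}"
    then have "w * z = z * w" using in_span_one_iff_central by blast
    then have "x * z = z * x" using wz by (metis mult.assoc)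
    then show False using nc by simp
  qed
  have v: "inverse w \<notin> span {1}"
  proof
    assume "inverse w \<in> span {1}"
    then have "inverse w * x = x * inverse w" using in_span_one_iff_central by blast
    then have "x * z = z * x" using vx by (metis mult.assoc)
    then show False using nc by simp
  qed
  have K: "span {1, w} = span {1, inverse w}"
  proof (rule proj_line_eq_span[OF line_through_one[OF w]])
    show "inverse w \<in> span {1, w}" using w0 by (intro commute_imp_in_span[OF w]) simp
  qed (use v in \<open>auto intro: span_base\<close>)
  have xK: "x \<notin> span {1, w}"
  proof
    assume "x \<in> span {1, w}"
    then have "inverse w * x = x * inverse w" unfolding K by (rule in_span_imp_commute)
    then have "x * z = z * x" using vx by (metis mult.assoc)
    then show False using nc by simp
  qed
  have zK: "z \<notin> span {1, w}"
  proof
    assume "z \<in> span {1, w}"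
    then have "w * z = z * w" by (rule in_span_imp_commute)
    then have "x * z = z * x" using wz by (metis mult.assoc)
    then show False using nc by simp
  qed
  obtain N where N: "(N, span {1, w}) \<in> R'" "x \<in> N"
    using parallel_exists[OF R' line_through_one[OF w] x0] .
  have zN: "z \<in> N"
    using double_space_left_type[OF D x v] xK N unfolding K vx by blast
  then have "z * w \<in> N" using double_space_right_type[OF D z w zK N(1)] by blast
  moreover have "N = span {z, x}"
  proof (rule proj_line_eq_span[OF parallel_in_proj_lines(1)[OF R' N(1)] zN N(2) z0])
    show "x \<notin> span {z}" using nc by (auto simp: span_singleton scale_mult_left scale_mult_right)
  qed
  ultimately obtain a b where "z * w = a *s z + b *s x" by (auto simp: span_pair_iff)
  moreover have "z * x = z * w * z" by (simp add: wz mult.assoc)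
  ultimately have "z * x = a *s (z * z) + b *s (x * z)"
    by (simp add: distrib_right scale_mult_left)
  then show thesis by (rule that)
qed

lemma independent_one_pair:
  assumes "x \<notin> span {1}" "z \<notin> span {1, x}" "a *s z + b *s x + c *s 1 = 0"
  shows "a = 0" "b = 0" "c = 0"
proof -
  show a: "a = 0"
  proof (rule ccontr)
    assume a: "a \<noteq> 0"
    have "a *s z = (- b) *s x + (- c) *s 1" using assms(3) by (simp add: algebra_simps eq_neg_iff_add_eq_0)
    then have "a *s z \<in> span {1, x}" by (simp only:) (intro span_add span_scale span_base, auto)
    then have "inverse a *s (a *s z) \<in> span {1, x}" by (rule span_scale)
    then show False using a assms(2) by simp
  qed
  show b: "b = 0"
  proof (rule ccontr)
    assume b: "b \<noteq> 0"
    have "b *s x = (- c) *s 1" using assms(3) a by (simp add: algebra_simps eq_neg_iff_add_eq_0)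
    then have "b *s x \<in> span {1}" by (simp only:) (intro span_scale span_base, auto)
    then have "inverse b *s (b *s x) \<in> span {1}" by (rule span_scale)
    then show False using b assms(1) by simp
  qed
  show "c = 0" using assms(3) a b by simp
qed

lemma span_one_translate: "span {1, x + c *s 1} = span {1, x}"
proof -
  have "x + c *s 1 \<in> span {1, x}" by (intro span_add span_scale span_base) auto
  moreover have "(x + c *s 1) - c *s 1 \<in> span {1, x + c *s 1}"
    by (intro span_diff span_scale span_base) auto
  ultimately show ?thesis unfolding span_eq by (auto intro: span_base)
qed

text \<open>Replacing \<open>x\<close> by \<open>x + 1\<close> in the relation \<open>z x = a z\<^sup>2 + b x z\<close> adds \<open>z\<close> to the left-hand side and
  must be matched by independent terms on the right-hand side, which gives \<open>b = 1\<close>.\<close>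

lemma left_right_type_commutator:
  assumes D: "projective_double_space R R'" and x: "left_type R x" and z: "right_type R z"
    and nc: "x * z \<noteq> z * x"
  obtains a where "z * x - x * z = a *s (z * z)"
proof -
  have R: "parallelism R" using D by (simp add: projective_double_space_def)
  have z0: "z \<noteq> 0" using nc by auto
  have x1: "x \<notin> span {1}" using nc in_span_one_iff_central by blast
  have zx: "z \<notin> span {1, x}" using nc in_span_imp_commute by blast
  obtain a b where ab: "z * x = a *s (z * z) + b *s (x * z)"
    using left_right_type_relation[OF D x z nc] .
  have nc': "(x + 1 *s 1) * z \<noteq> z * (x + 1 *s 1)" using nc by (simp add: algebra_simps)
  obtain a' b' where "z * (x + 1 *s 1) = a' *s (z * z) + b' *s ((x + 1 *s 1) * z)"
    using left_right_type_relation[OF D left_type_same_line[OF R x span_one_translate] z nc'] .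
  then have "z * x + z = a' *s (z * z) + b' *s (x * z) + b' *s z"
    by (simp add: distrib_left distrib_right scale_right_distrib)
  then have "(a' - a) *s (z * z) + (b' - b) *s (x * z) + (b' - 1) *s z = 0"
    unfolding ab by (simp add: algebra_simps)
  then have "((a' - a) *s z + (b' - b) *s x + (b' - 1) *s 1) * z = 0"
    by (simp add: distrib_right scale_mult_left left_diff_distrib)
  then have "(a' - a) *s z + (b' - b) *s x + (b' - 1) *s 1 = 0" using z0 by simp
  from independent_one_pair[OF x1 zx this] have "b = 1" by simp
  then have "z * x - x * z = a *s (z * z)" using ab by simp
  then show thesis by (rule that)
qed

text \<open>The commutator \<open>z x - x z\<close> is nonzero and does not change when a scalar \<open>t\<close> is added to \<open>z\<close>, but
  it is a multiple of \<open>(z + t)\<^sup>2\<close> for every \<open>t\<close>. So all these squares are proportional. Writing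
  \<open>z\<^sup>2 = p z + q\<close>, a comparison of the cases \<open>t = 0, 1, - 1\<close> gives \<open>p = 0\<close>; it also forces
  characteristic two, the only case in which such a pair can exist.\<close>

lemma left_right_type_square_central:
  assumes D: "projective_double_space R R'" and x: "left_type R x" and z: "right_type R z"
    and nc: "x * z \<noteq> z * x"
  obtains q k where "z * z = q *s 1" "z * x - x * z = k *s 1" "k \<noteq> 0"
proof -
  have R: "parallelism R" using D by (simp add: projective_double_space_def)
  have z1: "z \<notin> span {1}" using nc in_span_one_iff_central[of z] by metis
  have "z * z \<in> span {1, z}" by (intro commute_imp_in_span[OF z1]) (simp add: mult.assoc)
  then obtain q p where zz: "z * z = q *s 1 + p *s z" by (auto simp: span_pair_iff)
  have scaled: "\<exists>a. z * x - x * z = a *s ((p + 2 * t) *s z + (q + t * t) *s 1)" for t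
  proof -
    have nc': "x * (z + t *s 1) \<noteq> (z + t *s 1) * x" using nc by (simp add: algebra_simps)
    obtain a where "(z + t *s 1) * x - x * (z + t *s 1) = a *s ((z + t *s 1) * (z + t *s 1))"
      using left_right_type_commutator[OF D x right_type_same_line[OF R z span_one_translate] nc'] .
    moreover have "(z + t *s 1) * x - x * (z + t *s 1) = z * x - x * z"
      by (simp add: algebra_simps)
    moreover have "(z + t *s 1) * (z + t *s 1) = (p + 2 * t) *s z + (q + t * t) *s 1"
    proof -
      have "(z + t *s 1) * (z + t *s 1) = z * z + (t *s z + t *s z) + (t * t) *s 1"
        by (simp only: distrib_left distrib_right scalar_mult scale_right_distrib scale_scale add.assoc)
      also have "t *s z + t *s z = (2 * t) *s z" by (simp only: mult_2 scale_left_distrib)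
      finally show ?thesis by (simp add: zz scale_left_distrib)
    qed
    ultimately have "z * x - x * z = a *s ((p + 2 * t) *s z + (q + t * t) *s 1)" by (simp only:)
    then show ?thesis ..
  qed
  have eq: "a * p = b * p' \<and> a * q = b * q'"
    if "a *s (p *s z + q *s 1) = b *s (p' *s z + q' *s 1)" for a b p q p' q'
  proof -
    have "0 *s x + (a * p - b * p') *s z + (a * q - b * q') *s 1 = 0"
      using that by (simp add: algebra_simps)
    moreover have "x \<notin> span {1, z}" using nc in_span_imp_commute[of x z] by auto
    ultimately show ?thesis
      using independent_one_pair(2,3)[OF z1, of x 0 "a * p - b * p'" "a * q - b * q'"] by simp
  qed
  obtain a where a: "z * x - x * z = a *s (p *s z + q *s 1)" using scaled[of 0] by auto
  obtain b where b: "z * x - x * z = b *s ((p + 2) *s z + (q + 1) *s 1)" using scaled[of 1] by auto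
  obtain c where c: "z * x - x * z = c *s ((p - 2) *s z + (q + 1) *s 1)"
    using scaled[of "- 1"] by auto
  have a0: "a \<noteq> 0" using a nc by auto
  have ab: "a * p = b * (p + 2)" "a * q = b * (q + 1)" using eq[OF a[symmetric, THEN trans, OF b]] by simp_all
  have bc: "b * (p + 2) = c * (p - 2)" "b * (q + 1) = c * (q + 1)" using eq[OF b[symmetric, THEN trans, OF c]] by simp_all
  have b0: "b \<noteq> 0" using b nc by auto
  have q1: "q + 1 \<noteq> 0" using ab(2) a0 by auto
  then have "b = c" using bc(2) by simp
  then have "p + 2 = p - 2" using bc(1) b0 by simp
  then have "(p + 2) - (p - 2) = 0" by (simp only: right_minus_eq)
  moreover have "(p + 2) - (p - 2) = 2 * 2" by (simp add: algebra_simps)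
  ultimately have two: "(2 :: 'f) = 0" by (metis mult_eq_0_iff)
  have "p = 0"
  proof (rule ccontr)
    assume "p \<noteq> 0"
    then have "a = b" using ab(1) two by simp
    then show False using ab(2) a0 by simp
  qed
  then show thesis using that[of q "a * q"] zz a nc by (auto simp: algebra_simps)
qed

section \<open>The contradiction\<close>

text \<open>If \<open>u\<close> were a scalar \<open>c\<close>, then the relation between \<open>u\<close> and \<open>v\<close> gives \<open>2 c = 1\<close>, and then
  \<open>c\<^sup>2 = c + a\<close> says that the discriminant \<open>1 + 4 a\<close> vanishes.\<close>

lemma separable_element_noncentral:
  assumes "1 + 4 * a \<noteq> 0" "v \<noteq> 0" "u * u = u + a *s 1" "v * u = (1 - u) * v"
  shows "u \<notin> span {1}"
proof
  assume "u \<in> span {1}"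
  then obtain c where u: "u = c *s 1" by (auto simp: span_singleton)
  have inj: "d = e" if "d *s (1 :: 'h) = e *s 1" for d e using that by simp
  have "c *s v = v - c *s v" using assms(4) by (simp add: u left_diff_distrib)
  then have "c *s v + c *s v = v" by (simp add: eq_diff_eq)
  then have "(2 * c) *s v = 1 *s v" by (simp only: mult_2 scale_left_distrib scale_one)
  then have c: "2 * c = 1" using assms(2) by (simp only: scale_cancel_right) simp
  have "(c * c) *s (1 :: 'h) = (c + a) *s 1" using assms(3) by (simp add: u scale_left_distrib)
  then have "c * c = c + a" by (rule inj)
  then have "4 * (c * c) = 4 * (c + a)" by simp
  then have "(2 * c) * (2 * c) = 2 * (2 * c) + 4 * a" by (simp add: algebra_simps)
  then have "1 = 2 + 4 * a" unfolding c by simp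
  moreover have "(2 :: 'f) + 4 * a = 1 + (1 + 4 * a)" by simp
  ultimately show False using assms(1) by (metis add_cancel_right_right)
qed

text \<open>The generator \<open>u\<close> with \<open>u\<^sup>2 = u + a\<close> serves as the left or as the right member of a pair, with
  \<open>z\<close> or \<open>x\<close> as its partner. The partner does not commute with \<open>u\<close> since otherwise both would lie on
  one line through \<open>1\<close> and have the same types.\<close>

theorem clifford_like_double_space:
  assumes C: "clifford_like R" and D: "projective_double_space R R'"
  shows "R = left_parallel \<or> R = right_parallel"
proof (rule ccontr)
  assume "\<not> ?thesis"
  moreover have R: "parallelism R" using C by (simp add: clifford_like_def)
  ultimately obtain x z where x: "x \<notin> span {1}" "\<not> right_type R x"
    and z: "z \<notin> span {1}" "\<not> left_type R z"
    using all_left_type_imp_left_parallel all_right_type_imp_right_parallel by metis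
  have x': "left_type R x" and z': "right_type R z"
    using left_or_right_type[OF C] x z by blast+
  obtain a b u v where b: "b \<noteq> 0" and uv: "1 + 4 * a \<noteq> 0"
    "u * u = u + a *s 1" "v * v = b *s 1" "v * u = (1 - u) * v"
    using quaternion_basis by metis
  have "v \<noteq> 0" using b uv(3) by auto
  then have u: "u \<notin> span {1}" using separable_element_noncentral uv by blast
  have line_eq: "span {1, s} = span {1, t}"
    if "s * t = t * s" "s \<notin> span {1}" "t \<notin> span {1}" for s t
    using that commute_imp_in_span[of s t]
    by (intro proj_line_eq_span[OF line_through_one]) (auto intro: span_base)
  show False
  proof (cases "left_type R u")
    case True
    then have "u * z \<noteq> z * u"
      using left_type_same_line[OF R True] line_eq[OF _ u z(1)] z(2) by metis
    then obtain k where k: "z * u - u * z = k *s 1" "k \<noteq> 0"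
      using left_right_type_square_central[OF D True z'] by metis
    \<comment> \<open>As a commutator with \<open>z\<close> is a derivation and kills \<open>a\<close>, applying it to \<open>u\<^sup>2 = u + a\<close> gives
      \<open>2 k u = k\<close>.\<close>
    have "k *s 1 = z * (u * u) - (u * u) * z"
      using k(1) by (simp add: uv(2) algebra_simps)
    also have "\<dots> = (z * u - u * z) * u + u * (z * u - u * z)" by (simp add: algebra_simps)
    also have "\<dots> = (2 * k) *s u" by (simp only: k(1) scalar_mult mult_2 scale_left_distrib)
    finally have ku: "k *s 1 = (2 * k) *s u" .
    then have k2: "2 * k \<noteq> 0" using k(2) by auto
    have "inverse (2 * k) *s (k *s 1) \<in> span {1}" by (intro span_scale span_base) simp
    then show False using ku k2 u by simp
  next
    case False
    then have ur: "right_type R u" using left_or_right_type[OF C u] by blast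
    have "x * u \<noteq> u * x"
      using right_type_same_line[OF R ur] line_eq[OF _ x(1) u] x(2) by metis
    then obtain q where "u * u = q *s 1"
      using left_right_type_square_central[OF D x' ur] by metis
    then have "u = (q - a) *s 1" using uv(2) by (simp add: scale_left_diff_distrib eq_diff_eq)
    then show False using u by (auto simp: span_singleton)
  qed
qed

end

theorem theorem4p15:
  fixes scale :: "'f::field \<Rightarrow> 'h::division_ring \<Rightarrow> 'h"
    and R :: "('h set \<times> 'h set) set"
  assumes "quaternion_skew_field scale"
    and "quaternion_skew_field.clifford_like scale R"
    and "R \<noteq> quaternion_skew_field.left_parallel scale"
    and "R \<noteq> quaternion_skew_field.right_parallel scale"
  shows "\<not> (\<exists>R'. projective_space.parallelism scale R' \<and>
              projective_space.projective_double_space scale R R')"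
  using quaternion_skew_field.clifford_like_double_space[OF assms(1,2)] assms(3,4) by blast

end
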